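(* Let $N,n,m$ be integers with $N\geq4$, $1\leq m<N$ and $1\leq n<N$, let $X\sim\mathrm{Hyp}(N,n,m)$, and let $\mu=\mathbb{E}X$ and $\sigma^2=\operatorname{Var}X=\frac{mn(N-m)(N-n)}{(N-1)N^2}$. Then $$d_{\mathrm{TV}}\bigl(\mathscr{L}(X),\widehat{\mathrm{Bi}}(\mu,\sigma^2)\bigr)\leq\frac{\sqrt{6(N-2m)^2(N-2n)^2/N^3+130}}{2N^{1/2}\sigma}+\frac{1.4}{\sigma^2}.$$
   Context: $\mathrm{Hyp}(N,n,m)$ is the hypergeometric distribution: the number of good items when $n$ items are drawn without replacement from $N$ items, of which $m$ are labelled good. $\mathscr{L}(X)$ is the law of $X$. For probability measures $P,Q$ on $\mathbb{Z}$, $d_{\mathrm{TV}}(P,Q)=\sup_{A\subset\mathbb{Z}}|P[A]-Q[A]|$. For real $x$, $\lfloor x\rfloor$ and $\lceil x\rceil$ are the floor and ceiling, and $\langle x\rangle=x-\lfloor x\rfloor$. Given $\mu\in\mathbb{R}$ and $\sigma^2>0$, let $\delta=\langle-4\sigma^2\rangle$ (so $\lceil4\sigma^2\rceil=4\sigma^2+\delta$) and $t=\langle-\mu+2\sigma^2+\delta/2\rangle/\lceil4\sigma^2\rceil$. The translated (almost) symmetric binomial distribution $\widehat{\mathrm{Bi}}(\mu,\sigma^2)$ is the binomial distribution $\mathrm{Bi}(\lceil4\sigma^2\rceil,\tfrac12-t)$ shifted by $\mu-\lceil4\sigma^2\rceil(\tfrac12-t)$, i.e. the law of $Y+\mu-\lceil4\sigma^2\rceil(\tfrac12-t)$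 with $Y\sim\mathrm{Bi}(\lceil4\sigma^2\rceil,\tfrac12-t)$ (number of trials, success probability). The shift is an integer. The statement is understood whenever this is a genuine probability distribution, i.e. $\tfrac12-t\ge0$ (automatic if $\sigma^2>1/4$). *)

theory Defs
  imports "HOL-Probability.Probability"
begin

text \<open>Probability measures on the integers are represented by \<^typ>\<open>int pmf\<close>.\<close>

text \<open>The items are \<open>0, \<dots>, N - 1\<close>, the good ones are \<open>0, \<dots>, m - 1\<close>, and the drawn set is
  uniform among the sets of \<open>n\<close> items. The definition is meant for \<open>n \<le> N\<close> and \<open>m \<le> N\<close>.\<close>

definition hyp_pmf :: "nat \<Rightarrow> nat \<Rightarrow> nat \<Rightarrow> int pmf" where
  "hyp_pmf N n m =
     map_pmf (\<lambda>S. int (card (S \<inter> {..<m}))) (pmf_of_set {S. S \<subseteq> {..<N} \<and> card S = n})"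

definition d_TV :: "int pmf \<Rightarrow> int pmf \<Rightarrow> real" where
  "d_TV P Q = (SUP A. \<bar>measure_pmf.prob P A - measure_pmf.prob Q A\<bar>)"

definition tb_delta :: "real \<Rightarrow> real" where
  "tb_delta \<sigma>2 = frac (- (4 * \<sigma>2))"

definition tb_t :: "real \<Rightarrow> real \<Rightarrow> real" where
  "tb_t \<mu> \<sigma>2 = frac (- \<mu> + 2 * \<sigma>2 + tb_delta \<sigma>2 / 2) / of_int \<lceil>4 * \<sigma>2\<rceil>"

definition tb_shift :: "real \<Rightarrow> real \<Rightarrow> real" where
  "tb_shift \<mu> \<sigma>2 = \<mu> - of_int \<lceil>4 * \<sigma>2\<rceil> * (1 / 2 - tb_t \<mu> \<sigma>2)"

text \<open>The floor only converts the type: the shift is an integer, see \<open>tb_shift_in_Ints\<close> below.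
  The definition is meant for \<open>\<sigma>2 > 0\<close> and \<open>tb_t \<mu> \<sigma>2 \<le> 1 / 2\<close>, when \<open>1 / 2 - tb_t \<mu> \<sigma>2\<close>
  is a success probability.\<close>

definition Bi_hat :: "real \<Rightarrow> real \<Rightarrow> int pmf" where
  "Bi_hat \<mu> \<sigma>2 = map_pmf (\<lambda>k. int k + \<lfloor>tb_shift \<mu> \<sigma>2\<rfloor>)
     (binomial_pmf (nat \<lceil>4 * \<sigma>2\<rceil>) (1 / 2 - tb_t \<mu> \<sigma>2))"

lemma ceiling_eq_tb_delta: "of_int \<lceil>4 * \<sigma>2\<rceil> = 4 * \<sigma>2 + tb_delta \<sigma>2"
  by (simp add: tb_delta_def frac_def ceiling_def)

lemma tb_shift_in_Ints:
  assumes "\<sigma>2 > 0"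
  shows "tb_shift \<mu> \<sigma>2 \<in> \<int>"
proof -
  let ?x = "- \<mu> + 2 * \<sigma>2 + tb_delta \<sigma>2 / 2"
  have c: "\<lceil>4 * \<sigma>2\<rceil> \<noteq> 0"
    using assms by linarith
  have "of_int \<lceil>4 * \<sigma>2\<rceil> * tb_t \<mu> \<sigma>2 = frac ?x"
    using c by (simp add: tb_t_def)
  then have "tb_shift \<mu> \<sigma>2 = \<mu> - of_int \<lceil>4 * \<sigma>2\<rceil> / 2 + frac ?x"
    unfolding tb_shift_def by (simp add: right_diff_distrib)
  also have "\<dots> = - of_int \<lfloor>?x\<rfloor>"
    unfolding ceiling_eq_tb_delta frac_def by (simp add: field_simps)
  finally show ?thesis by simp
qed

lemma tb_t_nonneg:
  assumes "\<sigma>2 > 0"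
  shows "0 \<le> tb_t \<mu> \<sigma>2"
proof -
  have "0 \<le> \<lceil>4 * \<sigma>2\<rceil>"
    using assms by linarith
  then show ?thesis by (simp add: tb_t_def)
qed

lemma tb_t_less_half:
  assumes "\<sigma>2 > 1 / 4"
  shows "tb_t \<mu> \<sigma>2 < 1 / 2"
proof -
  let ?f = "frac (- \<mu> + 2 * \<sigma>2 + tb_delta \<sigma>2 / 2)"
  have "\<lceil>4 * \<sigma>2\<rceil> \<ge> 2"
    using assms by linarith
  then have c: "(of_int \<lceil>4 * \<sigma>2\<rceil> :: real) \<ge> 2"
    by linarith
  have "?f < 1"
    by (rule frac_lt_1)
  then have "?f < 1 / 2 * of_int \<lceil>4 * \<sigma>2\<rceil>"
    using c by linarith
  then show ?thesis
    unfolding tb_t_def using c by (subst pos_divide_less_eq) linarith+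
qed

end

theory Submission
  imports Defs
begin

text \<open>Stein's method. Write \<open>q = 1 - p\<close>, \<open>x = k - M p\<close> and \<open>\<Delta> = g (k + 1) - g k\<close>. In symmetric form
  the Stein equation of \<open>Bi(M, p)\<close> is
  \<open>M p q \<Delta> - x (g (k + 1) + g k) / 2 + (1 / 2 - p) x \<Delta> = 1\<^sub>A k - Bi(M, p) A\<close>;
  its solution has increments at most \<open>1 / (M p q)\<close> because, in the birth-death chain with
  rates \<open>p (M - k)\<close> and \<open>q k\<close>, the first rate decreases and the second increases.
  Swapping a drawn item with an undrawn one gives the hypergeometric law the reversible rates
  \<open>\<alpha> k = (n - k) (m - k)\<close> and \<open>\<beta> k = k (N - m - n + k)\<close>. Since \<open>\<alpha> - \<beta> = - N (k - \<mu>)\<close>,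
  it follows that \<open>E ((X - \<mu>) (g (X + 1) + g X) / 2) = E (V X (g (X + 1) - g X))\<close> with
  \<open>V = (\<alpha> + \<beta>) / (2 N)\<close> of mean \<open>\<sigma>\<^sup>2\<close>. Hence the distance is governed by
  \<open>E \<bar>V X - \<sigma>\<^sup>2\<bar> / \<sigma>\<^sup>2\<close>, which second and fourth moments of \<open>X\<close> control; these come from
  the same identity for linear and cubic \<open>g\<close>.\<close>

section \<open>Stein equation of a birth-death chain, and its binomial case\<close>

text \<open>Here \<open>d\<close> is the increment \<open>g (k + 1) - g k\<close> of the solution of
  \<open>a k * g (k + 1) - b k * g k = h k - H\<close>.\<close>

lemma birth_death_stein_bound:
  fixes a b \<pi> h :: "nat \<Rightarrow> real" and M :: nat
  assumes pos: "\<And>k. k \<le> M \<Longrightarrow> \<pi> k > 0" and one: "(\<Sum>k\<le>M. \<pi> k) = 1"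
    and balance: "\<And>k. k < M \<Longrightarrow> a k * \<pi> k = b (Suc k) * \<pi> (Suc k)"
    and a_anti: "\<And>j k. j \<le> k \<Longrightarrow> k \<le> M \<Longrightarrow> a k \<le> a j"
    and b_mono: "\<And>j k. j \<le> k \<Longrightarrow> k \<le> M \<Longrightarrow> b j \<le> b k"
    and a_pos: "\<And>k. k < M \<Longrightarrow> a k > 0" and b_pos: "\<And>k. 0 < k \<Longrightarrow> k \<le> M \<Longrightarrow> b k > 0"
    and h: "\<And>k. 0 \<le> h k" "\<And>k. h k \<le> 1"
    and k: "0 < k" "k < M"
  defines "H \<equiv> \<Sum>j\<le>M. \<pi> j * h j"
  defines "d \<equiv> (\<Sum>j<Suc k. \<pi> j * (h j - H)) / (a k * \<pi> k) - (\<Sum>j<k. \<pi> j * (h j - H)) / (b k * \<pi> k)"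
  shows "d \<le> 1 / a k" "d \<le> 1 / b k"
proof -
  define F where "F = (\<Sum>j<k. \<pi> j)"
  define R where "R = (\<Sum>j\<in>{k<..M}. \<pi> j)"
  define u where "u = (\<Sum>j<k. \<pi> j * h j)"
  define v where "v = (\<Sum>j\<in>{k<..M}. \<pi> j * h j)"
  define e where "e = \<pi> k * h k"
  have split: "(\<Sum>j\<le>M. f j) = (\<Sum>j<k. f j) + f k + (\<Sum>j\<in>{k<..M}. f j)" for f :: "nat \<Rightarrow> real"
  proof -
    have "{..M} = insert k ({..<k} \<union> {k<..M})" using k by auto
    moreover have "{..<k} \<inter> {k<..M} = {}" by auto
    ultimately show ?thesis by (simp add: sum.union_disjoint)
  qed
  have a: "a k > 0" and b: "b k > 0" and p: "\<pi> k > 0" using k a_pos b_pos pos by auto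
  have FR: "F + \<pi> k + R = 1" using one split[of \<pi>] by (simp add: F_def R_def)
  have H: "H = u + e + v" unfolding H_def split u_def e_def v_def by simp
  have uF: "0 \<le> u" using pos h k unfolding u_def by (intro sum_nonneg mult_nonneg_nonneg) (auto simp: less_imp_le)
  have vR: "0 \<le> v" using pos h k unfolding v_def by (intro sum_nonneg mult_nonneg_nonneg) (auto simp: less_imp_le)
  have e: "e \<le> \<pi> k" using h[of k] p by (simp add: e_def mult_left_le)
  have F0: "0 \<le> F" and R0: "0 \<le> R" using pos k unfolding F_def R_def by (auto intro!: sum_nonneg simp: less_imp_le)
  \<comment> \<open>Shift the tail above \<open>k\<close> by one step: balance turns
    \<open>b (Suc j) * \<pi> (Suc j)\<close> into \<open>a j * \<pi> j\<close>, and monotonicity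
    compares these rates with \<open>b k\<close> and \<open>a k\<close>. The bound \<open>aF\<close>
    is the mirror image below \<open>k\<close>.\<close>
  have bR: "b k * R \<le> a k * (R + \<pi> k)"
  proof -
    have "b k * R = (\<Sum>j\<in>{k..<M}. b k * \<pi> (Suc j))"
      unfolding R_def sum_distrib_left
      by (rule sum.reindex_bij_witness[of _ Suc "\<lambda>j. j - 1"]) auto
    also have "\<dots> \<le> (\<Sum>j\<in>{k..<M}. a k * \<pi> j)"
    proof (rule sum_mono)
      fix j assume j: "j \<in> {k..<M}"
      have "b k * \<pi> (Suc j) \<le> b (Suc j) * \<pi> (Suc j)"
        using j b_mono[of k "Suc j"] pos[of "Suc j"] by (intro mult_right_mono) auto
      also have "\<dots> = a j * \<pi> j" using balance j by auto
      also have "\<dots> \<le> a k * \<pi> j" using j a_anti[of k j] pos[of j] by (intro mult_right_mono) auto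
      finally show "b k * \<pi> (Suc j) \<le> a k * \<pi> j" .
    qed
    also have "\<dots> \<le> (\<Sum>j\<in>insert k {k<..M}. a k * \<pi> j)"
      using a pos k by (intro sum_mono2) (auto intro!: mult_nonneg_nonneg simp: less_imp_le)
    also have "\<dots> = a k * (R + \<pi> k)" by (simp add: R_def sum_distrib_left algebra_simps)
    finally show ?thesis .
  qed
  have aF: "a k * F \<le> b k * (F + \<pi> k)"
  proof -
    have "a k * F \<le> (\<Sum>j<k. b k * \<pi> (Suc j))" unfolding F_def sum_distrib_left
    proof (rule sum_mono)
      fix j assume j: "j \<in> {..<k}"
      have "a k * \<pi> j \<le> a j * \<pi> j"
        using j k a_anti[of j k] pos[of j] by (intro mult_right_mono) auto
      also have "\<dots> = b (Suc j) * \<pi> (Suc j)" using balance j k by auto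
      also have "\<dots> \<le> b k * \<pi> (Suc j)" using j k b_mono[of "Suc j" k] pos[of "Suc j"] by (intro mult_right_mono) auto
      finally show "a k * \<pi> j \<le> b k * \<pi> (Suc j)" .
    qed
    also have "\<dots> = (\<Sum>j\<in>{0<..k}. b k * \<pi> j)"
      by (rule sum.reindex_bij_witness[of _ "\<lambda>j. j - 1" Suc]) auto
    also have "\<dots> \<le> (\<Sum>j<Suc k. b k * \<pi> j)"
      using b pos k by (intro sum_mono2) (auto intro!: mult_nonneg_nonneg simp: less_imp_le)
    also have "\<dots> = b k * (F + \<pi> k)" by (simp add: F_def sum_distrib_left algebra_simps)
    finally show ?thesis .
  qed
  have S: "(\<Sum>j<k. \<pi> j * (h j - H)) = u - H * F"
    by (simp add: u_def F_def right_diff_distrib sum_subtractf sum_distrib_left mult.commute)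
  have S': "(\<Sum>j<Suc k. \<pi> j * (h j - H)) = u + e - H * (F + \<pi> k)"
    using S by (simp add: e_def algebra_simps)
  have d: "d * (a k * b k * \<pi> k) = (u + e - H * (F + \<pi> k)) * b k - (u - H * F) * a k"
    unfolding d_def S S' using a b p by (simp add: field_simps)
  have R: "R = 1 - F - \<pi> k" using FR by simp
  \<comment> \<open>Linear in the \<open>h\<close>-masses \<open>u\<close>, \<open>e\<close>,
    \<open>v\<close> below, at and above \<open>k\<close>. By \<open>bR\<close> and
    \<open>aF\<close> the coefficients of \<open>u\<close> and \<open>v\<close> are nonpositive, so
    only mass at \<open>k\<close> itself can raise the increment.\<close>
  have "(u + e - H * (F + \<pi> k)) * b k - (u - H * F) * a k =
      u * (b k * R - a k * (R + \<pi> k)) + v * (a k * F - b k * (F + \<pi> k)) + e * (b k * R + a k * F)"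
    unfolding H R by (simp add: algebra_simps)
  also have "\<dots> \<le> 0 + 0 + \<pi> k * (b k * R + a k * F)"
    using uF vR bR aF e F0 R0 a b
    by (intro add_mono mult_right_mono mult_nonneg_nonpos add_nonneg_nonneg mult_nonneg_nonneg) auto
  finally have main: "d * (a k * b k * \<pi> k) \<le> \<pi> k * (b k * R + a k * F)" using d by simp
  have "b k * R = b k - b k * (F + \<pi> k)" unfolding R by (simp add: algebra_simps)
  then have "b k * R + a k * F \<le> b k" using aF by linarith
  with main p have "d * (a k * b k * \<pi> k) \<le> \<pi> k * b k" by (smt (verit) mult_left_mono)
  then have "(d * a k) * (b k * \<pi> k) \<le> 1 * (b k * \<pi> k)" by (simp add: algebra_simps)
  then show "d \<le> 1 / a k" using a b p by (simp add: field_simps)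
  have "a k * F = a k - a k * (R + \<pi> k)" unfolding R by (simp add: algebra_simps)
  then have "b k * R + a k * F \<le> a k" using bR by linarith
  with main p have "d * (a k * b k * \<pi> k) \<le> \<pi> k * a k" by (smt (verit) mult_left_mono)
  then have "(d * b k) * (a k * \<pi> k) \<le> 1 * (a k * \<pi> k)" by (simp add: algebra_simps)
  then show "d \<le> 1 / b k" using a b p by (simp add: field_simps)
qed

text \<open>Real subtraction makes the absorption identity hold for all \<open>k\<close>: at
  \<open>k = M\<close> the factor vanishes, and beyond it both binomial coefficients do.\<close>

lemma real_Suc_times_binomial:
  "real (Suc k) * real (M choose Suc k) = (real M - real k) * real (M choose k)"
proof (cases "k < M")
  case True
  then obtain r where "M = Suc r" by (cases M) auto
  then have "Suc k * (M choose Suc k) = (M - k) * (M choose k)"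
    by (metis binomial_absorb_comp binomial_absorption diff_Suc_1)
  then show ?thesis using True by (metis less_imp_le of_nat_diff of_nat_mult)
qed (auto simp: not_less le_less binomial_eq_0)

lemma binomial_pmf_balance:
  fixes p :: real
  assumes "0 \<le> p" "p \<le> 1" "k < M"
  shows "p * (real M - real k) * pmf (binomial_pmf M p) k
    = (1 - p) * real (Suc k) * pmf (binomial_pmf M p) (Suc k)"
proof -
  obtain r where r: "M = Suc (k + r)" using assms(3) less_iff_Suc_add by blast
  have e: "M - k = Suc r" "M - Suc k = r" using r by auto
  show ?thesis
    using assms(1,2) arg_cong[OF real_Suc_times_binomial[of k M], of "\<lambda>y. y * (p * p ^ k * ((1 - p) * (1 - p) ^ r))"]
    by (simp add: e algebra_simps del: of_nat_Suc)
qed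

text \<open>By balance, multiplying the equation by \<open>\<pi> k\<close> turns its left side into
  \<open>S (Suc k) - S k\<close>, so partial sums solve it. Extending the solution by constants
  creates no further increments.\<close>

lemma binomial_stein_solution:
  fixes p :: real and h :: "nat \<Rightarrow> real"
  assumes p: "0 < p" "p < 1" and M: "0 < M"
    and h: "\<And>k. 0 \<le> h k" "\<And>k. h k \<le> 1"
  defines "H \<equiv> \<Sum>j\<le>M. pmf (binomial_pmf M p) j * h j"
  obtains g :: "int \<Rightarrow> real" where
    "\<And>k. k \<le> M \<Longrightarrow> p * (real M - real k) * g (int k + 1) - (1 - p) * real k * g (int k) = h k - H"
    "\<And>k. k \<le> 0 \<Longrightarrow> g k = g 1" "\<And>k. k \<ge> int M \<Longrightarrow> g k = g (int M)"
    "\<And>k. \<bar>g (k + 1) - g k\<bar> \<le> 1 / (M * p * (1 - p))"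
proof -
  define \<pi> where "\<pi> = pmf (binomial_pmf M p)"
  define a where "a k = p * (real M - real k)" for k :: nat
  define b where "b k = (1 - p) * real k" for k :: nat
  define S where "S k = (\<Sum>j<k. \<pi> j * (h j - H))" for k
  define f where "f k = S k / (b k * \<pi> k)" for k
  \<comment> \<open>\<open>f 0\<close> is a division by zero, but \<open>b 0\<close> and
    \<open>a M\<close> vanish, so the equation only sees the values of \<open>f\<close> at
    \<open>1\<close> to \<open>M\<close>. Clamping the index keeps exactly these.\<close>
  define g where "g k = f (nat (max 1 (min (int M) k)))" for k
  have pos: "\<pi> k > 0" if "k \<le> M" for k
    using p that unfolding \<pi>_def by simp
  have one: "(\<Sum>k\<le>M. \<pi> k) = 1"
    unfolding \<pi>_def using p by (intro sum_pmf_eq_1) (auto simp: set_pmf_binomial_eq)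
  have balance: "a k * \<pi> k = b (Suc k) * \<pi> (Suc k)" if "k < M" for k
    using binomial_pmf_balance[of p k M] p that by (simp add: a_def b_def \<pi>_def)
  have a_pos: "a k > 0" if "k < M" for k using that p by (simp add: a_def)
  have b_pos: "b k > 0" if "0 < k" for k using that p by (simp add: b_def)
  have a_anti: "a k \<le> a j" if "j \<le> k" for j k using that p by (simp add: a_def)
  have b_mono: "b j \<le> b k" if "j \<le> k" for j k using that p by (simp add: b_def)
  have H1: "H = (\<Sum>j\<le>M. \<pi> j * h j)" by (simp add: H_def \<pi>_def)
  \<comment> \<open>\<open>H\<close> is the mean of \<open>h\<close>, so the full sum vanishes. This
    settles the equation at \<open>k = M\<close>, where \<open>a M = 0\<close>.\<close>
  have S_end: "S (Suc M) = 0"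
    unfolding S_def lessThan_Suc_atMost right_diff_distrib sum_subtractf sum_distrib_right[symmetric] one H1 by simp
  have f_Suc: "f (Suc k) = S (Suc k) / (a k * \<pi> k)" if "k < M" for k
    using balance[OF that] by (simp add: f_def)
  have eq: "a k * f (Suc k) - b k * f k = h k - H" if k: "k \<le> M" for k
  proof -
    have 1: "a k * f (Suc k) * \<pi> k = S (Suc k)"
    proof (cases "k = M")
      case True then show ?thesis by (simp add: a_def S_end)
    next
      case False
      with k have "k < M" by simp
      then show ?thesis using a_pos[of k] pos[of k] by (simp add: f_Suc)
    qed
    have 2: "b k * f k * \<pi> k = S k"
    proof (cases "k = 0")
      case True then show ?thesis by (simp add: b_def S_def)
    next
      case False
      then show ?thesis using b_pos[of k] pos[of k] k by (simp add: f_def)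
    qed
    have "(a k * f (Suc k) - b k * f k) * \<pi> k = (h k - H) * \<pi> k"
      using 1 2 by (simp add: left_diff_distrib S_def) (simp add: algebra_simps)
    then show ?thesis using pos[OF k] by simp
  qed
  have d_le: "\<bar>f (Suc k) - f k\<bar> \<le> 1 / a k \<and> \<bar>f (Suc k) - f k\<bar> \<le> 1 / b k" if k: "0 < k" "k < M" for k
  proof -
    \<comment> \<open>Replacing \<open>h\<close> by \<open>1 - h\<close> negates the solution, so the upper bound gives the lower bound.\<close>
    note bd = birth_death_stein_bound[OF pos one balance a_anti b_mono a_pos b_pos _ _ k]
    have H2: "(\<Sum>j\<le>M. \<pi> j * (1 - h j)) = 1 - H"
      unfolding H1 right_diff_distrib sum_subtractf using one by simp
    have neg: "(\<Sum>j<l. \<pi> j * ((1 - h j) - (1 - H))) = - S l" for l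
      unfolding S_def sum_negf[symmetric] by (intro sum.cong) (auto simp: algebra_simps)
    have d: "f (Suc k) - f k = S (Suc k) / (a k * \<pi> k) - S k / (b k * \<pi> k)"
      using f_Suc k by (simp add: f_def)
    have "f (Suc k) - f k \<le> 1 / a k" "f (Suc k) - f k \<le> 1 / b k"
      unfolding d S_def H1 using bd[of h] h by blast+
    moreover have "- (f (Suc k) - f k) = - S (Suc k) / (a k * \<pi> k) - - S k / (b k * \<pi> k)"
      unfolding d by simp
    then have "- (f (Suc k) - f k) \<le> 1 / a k" "- (f (Suc k) - f k) \<le> 1 / b k"
      using bd[of "\<lambda>j. 1 - h j"] h unfolding H2 neg by auto
    ultimately show ?thesis by linarith
  qed
  show thesis
  proof
    show "p * (real M - real k) * g (int k + 1) - (1 - p) * real k * g (int k) = h k - H" if k: "k \<le> M" for k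
    proof -
      have "a k * g (int k + 1) = a k * f (Suc k)"
      proof (cases "k = M")
        case True then show ?thesis by (simp add: a_def)
      next
        case False
        with k have "nat (max 1 (min (int M) (int k + 1))) = Suc k" by linarith
        then show ?thesis by (simp add: g_def)
      qed
      moreover have "b k * g (int k) = b k * f k"
        using k M by (cases "k = 0") (auto simp: b_def g_def min_def max_def)
      ultimately have "a k * g (int k + 1) - b k * g (int k) = h k - H" using eq[OF k] by (simp only:)
      then show ?thesis by (simp only: a_def b_def)
    qed
    show "g k = g 1" if "k \<le> 0" for k
    proof -
      have "max 1 (min (int M) k) = max 1 (min (int M) 1)" using that M by linarith
      then show ?thesis by (simp only: g_def)
    qed
    show "g k = g (int M)" if "k \<ge> int M" for k
    proof -
      have "min (int M) k = min (int M) (int M)" using that by linarith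
      then show ?thesis by (simp only: g_def)
    qed
    show "\<bar>g (k + 1) - g k\<bar> \<le> 1 / (M * p * (1 - p))" for k
    proof (cases "0 < k \<and> k < int M")
      case False
      then have "max 1 (min (int M) (k + 1)) = max 1 (min (int M) k)" using M by linarith
      then have "g (k + 1) = g k" by (simp only: g_def)
      then show ?thesis using p by simp
    next
      case True
      define j where "j = nat k"
      have j: "0 < j" "j < M" "k = int j" using True by (auto simp: j_def)
      have g: "g (k + 1) - g k = f (Suc j) - f j"
      proof -
        have "nat (max 1 (min (int M) (k + 1))) = Suc j" "nat (max 1 (min (int M) k)) = j"
          using j by linarith+
        then show ?thesis by (simp only: g_def)
      qed
      have P: "M * p * (1 - p) > 0" using p M by simp
      show ?thesis
      \<comment> \<open>Up to the mean \<open>M * p\<close> the birth rate is at least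
        \<open>M * p * (1 - p)\<close>, and beyond it the death rate is.\<close>
      proof (cases "real j \<le> M * p")
        case True
        then have "M * p * (1 - p) \<le> a j"
          using p mult_left_mono[OF True, of p] by (simp add: a_def algebra_simps)
        then have "1 / a j \<le> 1 / (M * p * (1 - p))" using P by (intro divide_left_mono) auto
        then show ?thesis using d_le[of j] j g by simp
      next
        case False
        then have "M * p * (1 - p) \<le> b j"
          using p mult_left_mono[of "M * p" "real j" "1 - p"] by (simp add: b_def algebra_simps)
        then have "1 / b j \<le> 1 / (M * p * (1 - p))" using P by (intro divide_left_mono) auto
        then show ?thesis using d_le[of j] j g by simp
      qed
    qed
  qed
qed

section \<open>Total variation distance to a shifted binomial law\<close>

text \<open>Passing to the complement flips the sign of the difference, so a one-sided bound
  suffices. Cutting \<open>A\<close> down to \<open>I\<close> keeps its \<open>Q\<close>-mass and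
  can only lower its \<open>P\<close>-mass.\<close>

lemma d_TV_le:
  assumes "measure_pmf.prob Q I = 1"
    and le: "\<And>A. A \<subseteq> I \<Longrightarrow> measure_pmf.prob Q A - measure_pmf.prob P A \<le> B"
  shows "d_TV P Q \<le> B"
  unfolding d_TV_def
proof (rule cSUP_least)
  fix A :: "int set"
  have *: "measure_pmf.prob Q A - measure_pmf.prob P A \<le> B" for A
  proof -
    have "AE x in measure_pmf Q. x \<in> I"
      using assms(1) by (simp add: measure_pmf.prob_eq_1)
    then have "measure_pmf.prob Q A = measure_pmf.prob Q (A \<inter> I)"
      by (intro measure_pmf.finite_measure_eq_AE) auto
    moreover have "measure_pmf.prob P (A \<inter> I) \<le> measure_pmf.prob P A"
      by (intro measure_pmf.finite_measure_mono) auto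
    ultimately show ?thesis using le[of "A \<inter> I"] by simp
  qed
  have "measure_pmf.prob Q (- A) - measure_pmf.prob P (- A) = measure_pmf.prob P A - measure_pmf.prob Q A"
    using measure_pmf.prob_compl[of A Q] measure_pmf.prob_compl[of A P] by (simp add: Compl_eq_Diff_UNIV)
  with *[of A] *[of "- A"] show "\<bar>measure_pmf.prob P A - measure_pmf.prob Q A\<bar> \<le> B" by linarith
qed simp

lemma d_TV_le_1: "d_TV P Q \<le> 1"
proof (rule d_TV_le[of _ UNIV])
  fix A show "measure_pmf.prob Q A - measure_pmf.prob P A \<le> 1"
    using measure_pmf.prob_le_1[of Q A] measure_nonneg[of P A] by linarith
qed simp

text \<open>Beyond the binomial support the constantly extended solution no longer solves the Stein
  equation; with \<open>r\<close> the relative distance from the mean, the error is at most \<open>r\<^sup>2\<close>.\<close>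

lemma stein_tail_le_square:
  fixes r Q h :: real
  assumes "0 \<le> Q" "Q \<le> 1" "h = 0 \<or> h = 1" "1 \<le> r"
  shows "Q + r * (h - Q) \<le> r\<^sup>2"
proof -
  have "r \<le> r\<^sup>2" using assms(4) by (simp add: power2_eq_square)
  moreover have "r * (1 - Q) + Q \<le> r" "Q - r * Q \<le> r"
    using mult_right_mono[of 1 r Q] assms by (simp_all add: algebra_simps)
  ultimately show ?thesis using assms(3) by (auto simp: algebra_simps)
qed

text \<open>Integrate the binomial Stein equation under \<open>P\<close>. The identity assumed for
  \<open>P\<close> trades the drift for \<open>V\<close>, so the increment bound meets only the gap
  between \<open>V\<close> and the binomial variance and a skewness term. The last summand pays for
  points outside the binomial support.\<close>

lemma d_TV_shifted_binomial_le:
  fixes P :: "int pmf" and p c :: real and V :: "int \<Rightarrow> real" and M :: nat and s :: int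
  assumes fin: "finite (set_pmf P)"
    and p: "0 < p" "p \<le> 1 / 2" and M: "0 < M" and c: "c = real_of_int s + M * p"
    and stein: "\<And>g :: int \<Rightarrow> real. measure_pmf.expectation P (\<lambda>k. (k - c) * ((g (k + 1) + g k) / 2))
      = measure_pmf.expectation P (\<lambda>k. V k * (g (k + 1) - g k))"
  shows "d_TV P (map_pmf (\<lambda>k. int k + s) (binomial_pmf M p)) \<le>
    measure_pmf.expectation P (\<lambda>k. \<bar>M * p * (1 - p) - V k + (1 / 2 - p) * (k - c)\<bar>) / (M * p * (1 - p))
    + measure_pmf.expectation P (\<lambda>k. (k - c)\<^sup>2) / (M * p)\<^sup>2"
    (is "d_TV P ?Q \<le> ?E / ?v + ?W")
proof (rule d_TV_le)
  let ?I = "{s..s + int M}"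
  have "(\<lambda>k. int k + s) -` ?I = {..M}" by auto
  moreover have "measure_pmf.prob (binomial_pmf M p) {..M} = 1"
    using p by (subst measure_pmf.prob_eq_1) (auto simp: AE_measure_pmf_iff set_pmf_binomial_eq)
  ultimately show "measure_pmf.prob ?Q ?I = 1" by simp
  fix A assume A: "A \<subseteq> ?I"
  define h :: "nat \<Rightarrow> real" where "h j = of_bool (int j + s \<in> A)" for j
  define H where "H = (\<Sum>j\<le>M. pmf (binomial_pmf M p) j * h j)"
  have h: "0 \<le> h k" "h k \<le> 1" for k by (auto simp: h_def)
  have "measure_pmf.prob ?Q A = measure_pmf.prob (binomial_pmf M p) ((\<lambda>k. int k + s) -` A)" by simp
  also have "(\<lambda>k. int k + s) -` A = {j\<in>{..M}. int j + s \<in> A}" using A by auto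
  also have "measure_pmf.prob (binomial_pmf M p) \<dots> = H"
    unfolding H_def h_def by (subst measure_measure_pmf_finite) (auto intro!: sum.mono_neutral_cong_left)
  finally have QA: "measure_pmf.prob ?Q A = H" .
  then have H: "0 \<le> H" "H \<le> 1" by (metis measure_nonneg, metis measure_pmf.prob_le_1)
  obtain f where f: "\<And>k. k \<le> M \<Longrightarrow> p * (real M - real k) * f (int k + 1) - (1 - p) * real k * f (int k) = h k - H"
    and f0: "\<And>k. k \<le> 0 \<Longrightarrow> f k = f 1" and fM: "\<And>k. k \<ge> int M \<Longrightarrow> f k = f (int M)"
    and fd: "\<And>k. \<bar>f (k + 1) - f k\<bar> \<le> 1 / ?v"
    using binomial_stein_solution[of p M h] p M h unfolding H_def by auto
  define g where "g k = f (k - s)" for k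
  define T where "T k = ?v * (g (k + 1) - g k) - (k - c) * ((g (k + 1) + g k) / 2) + (1 / 2 - p) * (k - c) * (g (k + 1) - g k)" for k
  \<comment> \<open>The symmetric form is the Stein operator of
    \<open>binomial_stein_solution\<close> shifted by \<open>s\<close>, because \<open>c\<close> is
    the mean of the shifted law.\<close>
  have T: "T k = p * (M - real_of_int (k - s)) * f (k - s + 1) - (1 - p) * real_of_int (k - s) * f (k - s)" for k
    unfolding T_def g_def c by (simp add: algebra_simps add_divide_distrib diff_divide_distrib)
  have Mp: "0 < M * p" using M p by simp
  have pt: "H - indicator A k \<le> - T k + (k - c)\<^sup>2 / (M * p)\<^sup>2" for k
  proof -
    consider "k < s" | "s \<le> k" "k \<le> s + M" | "k > s + M" by linarith
    then show ?thesis
    proof cases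
      case 2
      define j where "j = nat (k - s)"
      have j: "k = int j + s" "j \<le> M" using 2 by (auto simp: j_def)
      have "T k = h j - H" unfolding T using f[OF j(2)] j(1) by simp
      then show ?thesis by (auto simp: h_def j indicator_def)
    next
      case 1
      then have A0: "indicator A k = (0::real)" using A by (auto simp: indicator_def)
      define r where "r = (c - k) / (M * p)"
      have "1 \<le> r" unfolding r_def using Mp 1 by (simp add: c)
      \<comment> \<open>Both values of \<open>f\<close> in \<open>T k\<close> equal
        \<open>f 1\<close> here, and the equation at \<open>0\<close> identifies this value, so
        \<open>T k\<close> is \<open>h 0 - H\<close> magnified by \<open>r\<close>.\<close>
      have f1: "M * p * f 1 = h 0 - H" using f[of 0] by (simp add: mult.commute)
      have "T k = (c - k) * f 1"
        unfolding T using f0[of "k - s"] f0[of "k - s + 1"] 1 by (simp add: c algebra_simps)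
      also have "\<dots> = r * (M * p * f 1)" using M p by (simp add: r_def)
      finally have "T k = r * (h 0 - H)" unfolding f1 .
      moreover have "H + r * (h 0 - H) \<le> r\<^sup>2"
        using stein_tail_le_square[of H "h 0" r] H \<open>1 \<le> r\<close> by (auto simp: h_def)
      moreover have "r\<^sup>2 = (k - c)\<^sup>2 / (M * p)\<^sup>2"
        by (simp add: r_def power_divide power2_commute)
      ultimately show ?thesis using A0 by (simp add: algebra_simps)
    next
      case 3
      then have A0: "indicator A k = (0::real)" using A by (auto simp: indicator_def)
      have Mq: "0 < M * (1 - p)" using M p by simp
      define r where "r = (k - c) / (M * (1 - p))"
      have "real_of_int k \<ge> s + real M" using 3 by linarith
      then have "1 \<le> r" unfolding r_def using Mq by (simp add: c algebra_simps)
      have fM1: "- (M * (1 - p) * f (int M)) = h M - H" using f[of M] by (simp add: mult_ac)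
      have "T k = - ((k - c) * f (int M))"
        unfolding T using fM[of "k - s"] fM[of "k - s + 1"] 3 by (simp add: c algebra_simps)
      also have "\<dots> = r * - (M * (1 - p) * f (int M))" using M p by (simp add: r_def)
      finally have "T k = r * (h M - H)" unfolding fM1 .
      moreover have "H + r * (h M - H) \<le> r\<^sup>2"
        using stein_tail_le_square[of H "h M" r] H \<open>1 \<le> r\<close> by (auto simp: h_def)
      \<comment> \<open>As \<open>p \<le> 1 / 2\<close>, the left distance \<open>M * p\<close> is
        at most the right one, \<open>M * (1 - p)\<close>, so one denominator serves both
        tails.\<close>
      moreover have "r\<^sup>2 \<le> (k - c)\<^sup>2 / (M * p)\<^sup>2"
        unfolding r_def power_divide using p M Mp Mq
        by (intro divide_left_mono power_mono mult_left_mono mult_pos_pos zero_less_power) auto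
      ultimately show ?thesis using A0 by simp
    qed
  qed
  note int = integrable_measure_pmf_finite[OF fin]
  let ?D = "\<lambda>k. M * p * (1 - p) - V k + (1 / 2 - p) * (k - c)"
  \<comment> \<open>Insert \<open>V k\<close> times the increment; by \<open>stein\<close> its
    expectation cancels the drift term.\<close>
  have "T = (\<lambda>k. ?D k * (g (k + 1) - g k) + V k * (g (k + 1) - g k) - (k - c) * ((g (k + 1) + g k) / 2))"
    by (simp add: T_def fun_eq_iff algebra_simps)
  then have "measure_pmf.expectation P T = measure_pmf.expectation P (\<lambda>k. ?D k * (g (k + 1) - g k) + V k * (g (k + 1) - g k))
      - measure_pmf.expectation P (\<lambda>k. (k - c) * ((g (k + 1) + g k) / 2))"
    by (simp only: Bochner_Integration.integral_diff[OF int int])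
  then have ET: "measure_pmf.expectation P T = measure_pmf.expectation P (\<lambda>k. ?D k * (g (k + 1) - g k))"
    unfolding stein Bochner_Integration.integral_add[OF int int] by linarith
  have "- measure_pmf.expectation P T \<le> measure_pmf.expectation P (\<lambda>k. \<bar>?D k\<bar> * (1 / ?v))"
    unfolding ET Bochner_Integration.integral_minus[symmetric]
  proof (intro integral_mono int)
    fix k
    have "- (?D k * (g (k + 1) - g k)) \<le> \<bar>?D k\<bar> * \<bar>g (k + 1) - g k\<bar>"
      by (metis abs_ge_minus_self abs_mult)
    also have "\<dots> \<le> \<bar>?D k\<bar> * (1 / ?v)"
      using fd[of "k - s"] by (intro mult_left_mono) (auto simp: g_def algebra_simps)
    finally show "- (?D k * (g (k + 1) - g k)) \<le> \<bar>?D k\<bar> * (1 / ?v)" .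
  qed
  then have E: "- measure_pmf.expectation P T \<le> ?E / ?v" by simp
  have "measure_pmf.prob ?Q A - measure_pmf.prob P A = measure_pmf.expectation P (\<lambda>k. H - indicator A k)"
    unfolding QA by (subst Bochner_Integration.integral_diff) (auto simp: int)
  also have "\<dots> \<le> measure_pmf.expectation P (\<lambda>k. - T k + (k - c)\<^sup>2 / (M * p)\<^sup>2)"
    by (intro integral_mono int pt)
  also have "\<dots> = - measure_pmf.expectation P T + ?W"
    by (subst Bochner_Integration.integral_add) (auto simp: int)
  finally show "measure_pmf.prob ?Q A - measure_pmf.prob P A \<le> ?E / ?v + ?W" using E by linarith
qed

section \<open>Hypergeometric law: point probabilities, support, reversibility\<close>

text \<open>The \<open>k\<close> good and the \<open>n - k\<close> bad items of \<open>S\<close> are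
  chosen independently; union inverts the splitting.\<close>

lemma card_subsets_inter:
  assumes "m \<le> N" "k \<le> n"
  shows "card {S. S \<subseteq> {..<N} \<and> card S = n \<and> card (S \<inter> {..<m}) = k}
    = (m choose k) * ((N - m) choose (n - k))"
proof -
  let ?X = "{A. A \<subseteq> {..<m} \<and> card A = k} \<times> {B. B \<subseteq> {m..<N} \<and> card B = n - k}"
  let ?Y = "{S. S \<subseteq> {..<N} \<and> card S = n \<and> card (S \<inter> {..<m}) = k}"
  have "bij_betw (\<lambda>S. (S \<inter> {..<m}, S - {..<m})) ?Y ?X"
  proof (rule bij_betw_byWitness[where f' = "\<lambda>(A, B). A \<union> B"])
    show "(\<lambda>S. (S \<inter> {..<m}, S - {..<m})) ` ?Y \<subseteq> ?X"
      using assms by (auto simp: card_Diff_subset_Int)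
    show "(\<lambda>(A, B). A \<union> B) ` ?X \<subseteq> ?Y"
    proof (clarsimp, intro conjI)
      fix A B assume A: "A \<subseteq> {..<m}" and B: "B \<subseteq> {m..<N}" "card B = n - card A" and k: "k = card A"
      have fin: "finite A" "finite B" using A B finite_subset by auto
      have "A \<inter> B = {}" using A B by force
      then show "card (A \<union> B) = n" using B(2) fin assms(2) k by (simp add: card_Un_disjoint)
      have "(A \<union> B) \<inter> {..<m} = A" using A B by force
      then show "card ((A \<union> B) \<inter> {..<m}) = card A" by simp
      show "A \<subseteq> {..<N}" using A assms(1) by force
      show "B \<subseteq> {..<N}" using B by force
    qed
  qed (auto simp: subset_iff)
  then have "card ?Y = card ?X" by (rule bij_betw_same_card)
  also have "\<dots> = (m choose k) * ((N - m) choose (n - k))"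
    by (simp add: card_cartesian_product n_subsets)
  finally show ?thesis .
qed

lemma pmf_hyp_pmf:
  assumes "m \<le> N" "n \<le> N" "k \<le> n"
  shows "pmf (hyp_pmf N n m) (int k) = real (m choose k) * real ((N - m) choose (n - k)) / real (N choose n)"
proof -
  let ?S = "{S. S \<subseteq> {..<N} \<and> card S = n}"
  have fin: "finite ?S" by (rule finite_subset[of _ "Pow {..<N}"]) auto
  have c: "card ?S = N choose n" using n_subsets[of "{..<N}" n] by simp
  then have ne: "?S \<noteq> {}" using assms by (metis binomial_eq_0_iff card.empty not_le)
  have "(\<lambda>S. int (card (S \<inter> {..<m}))) -` {int k} \<inter> ?S = {S. S \<subseteq> {..<N} \<and> card S = n \<and> card (S \<inter> {..<m}) = k}"
    by auto
  then show ?thesis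
    unfolding hyp_pmf_def pmf_map
    using card_subsets_inter[OF assms(1,3)] fin ne c by (simp add: measure_pmf_of_set Int_commute)
qed

text \<open>Inclusion-exclusion gives the lower end. On this range all four cells of the table drawn
  or undrawn by good or bad are nonnegative.\<close>

lemma set_pmf_hyp_pmf:
  assumes "m \<le> N" "n \<le> N"
  shows "set_pmf (hyp_pmf N n m) \<subseteq> {max 0 (int n + int m - int N)..int (min n m)}"
proof -
  let ?S = "{S. S \<subseteq> {..<N} \<and> card S = n}"
  have fin: "finite ?S" by (rule finite_subset[of _ "Pow {..<N}"]) auto
  have c: "card ?S = N choose n" using n_subsets[of "{..<N}" n] by simp
  then have ne: "?S \<noteq> {}" using assms by (metis binomial_eq_0_iff card.empty not_le)
  show ?thesis unfolding hyp_pmf_def set_map_pmf set_pmf_of_set[OF ne fin]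
  proof (clarify)
    fix S assume S: "S \<subseteq> {..<N}" "n = card S"
    have fS: "finite S" using S finite_subset by auto
    have 1: "card (S \<inter> {..<m}) \<le> card S" using fS by (intro card_mono) auto
    have 2: "card (S \<inter> {..<m}) \<le> m" using card_mono[of "{..<m}" "S \<inter> {..<m}"] by auto
    have "card (S \<union> {..<m}) \<le> N" using card_mono[of "{..<N}" "S \<union> {..<m}"] S assms by auto
    moreover have "card S + m = card (S \<union> {..<m}) + card (S \<inter> {..<m})"
      using card_Un_Int[of S "{..<m}"] fS by simp
    ultimately show "int (card (S \<inter> {..<m})) \<in> {max 0 (int (card S) + int m - int N)..int (min (card S) m)}"
      using 1 2 by auto
  qed
qed

text \<open>Detailed balance for swaps of a drawn and an undrawn item:
  \<open>(n - k) * (m - k)\<close> of them gain a good item, \<open>k * (N - m - n + k)\<close> lose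
  one. At \<open>k = -1\<close> and \<open>k = n\<close> both sides vanish, so all integers are
  covered.\<close>

lemma hyp_pmf_balance:
  assumes "m \<le> N" "n \<le> N"
  shows "pmf (hyp_pmf N n m) k * ((n - real_of_int k) * (m - real_of_int k))
    = pmf (hyp_pmf N n m) (k + 1) * ((k + 1) * (real N - m - n + k + 1))"
proof -
  have out: "pmf (hyp_pmf N n m) j = 0" if "j < 0 \<or> j > n" for j :: int
    using set_pmf_hyp_pmf[OF assms] that by (fastforce simp: pmf_eq_0_set_pmf)
  consider "k < -1" | "k = -1" | "k = n" | "k > n" | "0 \<le> k" "k < n" by linarith
  then show ?thesis
  proof cases
    case 5
    define j where "j = nat k"
    have j: "k = int j" "j < n" using 5 by (auto simp: j_def)
    obtain r where r: "n = Suc (j + r)" using j(2) less_iff_Suc_add by blast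
    have e: "n - j = Suc r" "n - Suc j = r" using r by auto
    have c1: "real (Suc j) * real (m choose Suc j) = (real m - real j) * real (m choose j)"
      by (rule real_Suc_times_binomial)
    have c2: "real (Suc r) * real ((N - m) choose Suc r) = (real N - real m - real r) * real ((N - m) choose r)"
      using real_Suc_times_binomial[of r "N - m"] assms by (simp add: of_nat_diff)
    have p1: "pmf (hyp_pmf N n m) k = real (m choose j) * real ((N - m) choose Suc r) / real (N choose n)"
      using pmf_hyp_pmf[OF assms, of j] j e by simp
    have p2: "pmf (hyp_pmf N n m) (k + 1) = real (m choose Suc j) * real ((N - m) choose r) / real (N choose n)"
      using pmf_hyp_pmf[OF assms, of "Suc j"] j e by (simp add: add.commute)
    have "real (m choose j) * (m - real j) * (real ((N - m) choose Suc r) * real (Suc r)) =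
        real (m choose Suc j) * real (Suc j) * (real ((N - m) choose r) * (real N - m - r))"
      using c1 c2 by (simp only: mult.commute)
    then have "(real (m choose j) * real ((N - m) choose Suc r)) * (real (Suc r) * (m - real j))
       = (real (m choose Suc j) * real ((N - m) choose r)) * (real (Suc j) * (real N - m - r))"
      by (simp only: mult_ac)
    note main = this
    have eqs: "n - real_of_int k = Suc r" "m - real_of_int k = m - real j"
      "real_of_int k + 1 = Suc j" "real N - m - n + k + 1 = real N - m - r"
      using j r by auto
    show ?thesis unfolding p1 p2 eqs times_divide_eq_left main of_int_add of_int_1 ..
  qed (use out[of k] out[of "k + 1"] in auto)
qed

text \<open>Multiply the balance by \<open>g (k + 1)\<close>, sum, and shift the index. The ranges
  from \<open>-1\<close> to \<open>n\<close> and from \<open>0\<close> to \<open>n + 1\<close>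
  correspond, and their additional end points carry no mass.\<close>

lemma hyp_pmf_stein:
  fixes g :: "int \<Rightarrow> real"
  assumes "m \<le> N" "n \<le> N"
  shows "measure_pmf.expectation (hyp_pmf N n m) (\<lambda>k. (n - real_of_int k) * (m - real_of_int k) * g (k + 1))
    = measure_pmf.expectation (hyp_pmf N n m) (\<lambda>k. k * (real N - m - n + k) * g k)"
proof -
  let ?P = "hyp_pmf N n m"
  have sub: "set_pmf ?P \<subseteq> {0..int n}" using set_pmf_hyp_pmf[OF assms] by force
  have E: "measure_pmf.expectation ?P f = (\<Sum>k\<in>K. f k * pmf ?P k)" if "{0..int n} \<subseteq> K" "finite K" for f :: "int \<Rightarrow> real" and K
    using that sub by (subst integral_measure_pmf_real[of K]) auto
  have "measure_pmf.expectation ?P (\<lambda>k. (n - real_of_int k) * (m - real_of_int k) * g (k + 1))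
     = (\<Sum>k\<in>{-1..int n}. (pmf ?P k * ((n - real_of_int k) * (m - real_of_int k))) * g (k + 1))"
    by (subst E[of "{-1..int n}"]) (auto simp: mult_ac)
  also have "\<dots> = (\<Sum>k\<in>{0..int n + 1}. k * (real N - m - n + k) * g k * pmf ?P k)"
    unfolding hyp_pmf_balance[OF assms]
    by (rule sum.reindex_bij_witness[of _ "\<lambda>k. k - 1" "\<lambda>k. k + 1"]) (auto simp: algebra_simps)
  also have "\<dots> = measure_pmf.expectation ?P (\<lambda>k. k * (real N - m - n + k) * g k)"
    by (subst E[of "{0..int n + 1}"]) auto
  finally show ?thesis .
qed

section \<open>Moments of the hypergeometric law from its Stein identity\<close>

text \<open>The variance of the absolute value of \<open>f\<close> is nonnegative.\<close>

lemma expectation_abs_le_sqrt: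
  fixes f :: "'a \<Rightarrow> real"
  assumes "finite (set_pmf P)"
  shows "measure_pmf.expectation P (\<lambda>k. \<bar>f k\<bar>) \<le> sqrt (measure_pmf.expectation P (\<lambda>k. (f k)\<^sup>2))"
proof -
  note int = integrable_measure_pmf_finite[OF assms]
  have "0 \<le> measure_pmf.variance P (\<lambda>k. \<bar>f k\<bar>)" by simp
  also have "\<dots> = measure_pmf.expectation P (\<lambda>k. (f k)\<^sup>2) - (measure_pmf.expectation P (\<lambda>k. \<bar>f k\<bar>))\<^sup>2"
    by (subst measure_pmf.variance_eq) (auto simp: int)
  finally show ?thesis by (intro real_le_rsqrt) simp
qed

text \<open>\<open>c\<close> and \<open>v\<close> turn out to be the mean and the variance.
  \<open>V\<close> is the sum of the two swap rates divided by \<open>2 * N\<close>, expanded about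
  \<open>c\<close>: its deviation from \<open>v\<close> has a quadratic part with factor
  \<open>1 / N\<close> and a linear part governed by the asymmetry \<open>\<theta>\<close>.\<close>

context
  fixes N n m :: nat and c v \<theta> :: real and V :: "int \<Rightarrow> real"
  assumes N: "2 \<le> N" and le: "m \<le> N" "n \<le> N"
  defines "c \<equiv> real n * real m / real N"
    and "v \<equiv> real m * real n * (real N - real m) * (real N - real n) / ((real N - 1) * (real N)\<^sup>2)"
    and "\<theta> \<equiv> (real N - 2 * real m) * (real N - 2 * real n) / (real N)\<^sup>2"
    and "V \<equiv> \<lambda>k. v + ((real_of_int k - c)\<^sup>2 - v) / N + (k - c) * \<theta> / 2"
begin

lemma finite_set_hyp_pmf: "finite (set_pmf (hyp_pmf N n m))"
  using set_pmf_hyp_pmf[OF le] by (rule finite_subset) simp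

lemmas hyp_int = integrable_measure_pmf_finite[OF finite_set_hyp_pmf]

abbreviation (input) EH :: "(int \<Rightarrow> real) \<Rightarrow> real" where "EH f \<equiv> measure_pmf.expectation (hyp_pmf N n m) f"

lemma EH_cmult: "EH (\<lambda>k. a * f k) = a * EH f" for f :: "int \<Rightarrow> real"
  by simp

lemma EH_add: "EH (\<lambda>k. f k + g k) = EH f + EH g" for f g :: "int \<Rightarrow> real"
  by (rule Bochner_Integration.integral_add) (rule hyp_int)+

lemma EH_diff: "EH (\<lambda>k. f k - g k) = EH f - EH g" for f g :: "int \<Rightarrow> real"
  by (rule Bochner_Integration.integral_diff) (rule hyp_int)+

lemma hyp_V:
  "V k = ((n - real_of_int k) * (m - real_of_int k) + k * (real N - m - n + k)) / (2 * N)"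
proof -
  have "(real N - 1) * v = real m * real n * (real N - real m) * (real N - real n) / (real N)\<^sup>2"
    using N by (simp add: v_def)
  moreover have "2 * N * V k = 2 * ((real N - 1) * v) + 2 * (k - c)\<^sup>2 + (k - c) * N * \<theta>"
    using N by (simp add: V_def field_simps)
  moreover have "2 * (real m * real n * (real N - real m) * (real N - real n) / (real N)\<^sup>2) + 2 * (k - c)\<^sup>2 + (k - c) * N * \<theta>
      = (n - real_of_int k) * (m - real_of_int k) + k * (real N - m - n + k)"
    using N unfolding c_def \<theta>_def by (simp add: field_simps power2_eq_square)
  ultimately have "2 * N * V k = (n - real_of_int k) * (m - real_of_int k) + k * (real N - m - n + k)"
    by (simp only:)
  then show ?thesis using N by (simp add: field_simps)
qed

text \<open>The swap rates have difference \<open>- N * (k - c)\<close> and sum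
  \<open>2 * N * V k\<close>, so this is \<open>hyp_pmf_stein\<close> in symmetric form.\<close>

lemma hyp_stein_centered:
  fixes g :: "int \<Rightarrow> real"
  shows "EH (\<lambda>k. (k - c) * ((g (k + 1) + g k) / 2)) = EH (\<lambda>k. V k * (g (k + 1) - g k))"
proof -
  have "(k - c) * ((g (k + 1) + g k) / 2) - V k * (g (k + 1) - g k) =
      (- 1 / N) * ((n - real_of_int k) * (m - real_of_int k) * g (k + 1) - k * (real N - m - n + k) * g k)" for k
    unfolding hyp_V c_def using N by (simp add: field_simps)
  then have "EH (\<lambda>k. (k - c) * ((g (k + 1) + g k) / 2)) - EH (\<lambda>k. V k * (g (k + 1) - g k)) =
    (- 1 / N) * (EH (\<lambda>k. (n - real_of_int k) * (m - real_of_int k) * g (k + 1)) - EH (\<lambda>k. k * (real N - m - n + k) * g k))"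
    by (simp only: EH_diff[symmetric] EH_cmult)
  then show ?thesis using hyp_pmf_stein[OF le, of g] by simp
qed

lemma hyp_centered: "EH (\<lambda>k. k - c) = 0"
  using hyp_stein_centered[of "\<lambda>_. 1"] by simp

lemma hyp_mean: "EH real_of_int = c"
  using hyp_centered EH_diff[of real_of_int "\<lambda>_. c"] by simp

text \<open>Test with \<open>k - c - 1 / 2\<close>: the half makes the average over \<open>k\<close>
  and \<open>k + 1\<close> equal to \<open>k - c\<close>, and the increment is
  \<open>1\<close>.\<close>

lemma hyp_second_moment_V: "EH (\<lambda>k. (k - c)\<^sup>2) = EH V"
proof -
  have "((k + 1 - c - 1 / 2) + (k - c - 1 / 2)) / 2 = k - c" "(k + 1 - c - 1 / 2) - (k - c - 1 / 2) = 1" for k :: real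
    by (simp_all add: field_simps)
  then show ?thesis
    using hyp_stein_centered[of "\<lambda>k. k - c - 1 / 2"]
    by (simp only: of_int_add of_int_1 power2_eq_square mult_1_right)
qed

text \<open>\<open>V\<close> itself contains the square of \<open>k - c\<close>, so the preceding
  identity is a linear equation for the second moment.\<close>

lemma hyp_second_moment: "EH (\<lambda>k. (k - c)\<^sup>2) = v"
proof -
  note hyp_second_moment_V
  also have "EH V = EH (\<lambda>k. (v - v / N) + (1 / N) * (k - c)\<^sup>2 + \<theta> / 2 * (k - c))"
    by (simp add: V_def diff_divide_distrib algebra_simps)
  also have "\<dots> = (v - v / N) + (1 / N) * EH (\<lambda>k. (k - c)\<^sup>2)"
    by (simp only: EH_add EH_cmult hyp_centered) simp
  finally have "(1 - 1 / N) * (EH (\<lambda>k. (k - c)\<^sup>2) - v) = 0" by (simp add: algebra_simps)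
  then show ?thesis using N by auto
qed

lemma hyp_mean_V: "EH V = v"
  using hyp_second_moment_V hyp_second_moment by simp

text \<open>The numerator of \<open>V\<close> is \<open>x * y + z * w\<close>, part of the product
  \<open>(x + z) * (y + w) = n * (N - n)\<close>, which is at most \<open>N^2 / 4\<close>.\<close>

lemma hyp_V_le: "k \<in> set_pmf (hyp_pmf N n m) \<Longrightarrow> V k \<le> N / 8"
proof -
  assume "k \<in> set_pmf (hyp_pmf N n m)"
  then have k: "0 \<le> k" "int n + int m - int N \<le> k" "k \<le> n" "k \<le> m"
    using set_pmf_hyp_pmf[OF le] by (auto simp: min_def split: if_splits)
  \<comment> \<open>The numbers of drawn bad, undrawn good, drawn good and undrawn bad
    items.\<close>
  define x y z w where "x = real n - k" and "y = real m - k" and "z = real_of_int k" and "w = real N - m - n + k"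
  have "0 \<le> x" "0 \<le> y" "0 \<le> z" "0 \<le> w" using k unfolding x_def y_def z_def w_def by linarith+
  then have "x * y + z * w \<le> (x + z) * (y + w)" by (simp add: algebra_simps)
  also have "\<dots> = n * (real N - n)" by (simp add: x_def y_def z_def w_def)
  also have "\<dots> \<le> (real N)\<^sup>2 / 4"
    using zero_le_power2[of "real N - 2 * n"] by (simp add: power2_eq_square algebra_simps)
  finally have "x * y + z * w \<le> (real N)\<^sup>2 / 4" .
  then show ?thesis using N unfolding hyp_V x_def y_def z_def w_def by (simp add: field_simps power2_eq_square)
qed

text \<open>A cubic test function, again centred by \<open>1 / 2\<close>, expresses the fourth
  moment through the mean of \<open>V k * (k - c)^2\<close>; then \<open>hyp_V_le\<close> reduces it
  to the second moment.\<close>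

lemma hyp_fourth_moment: "EH (\<lambda>k. (k - c)^4) \<le> (3 * N / 8 + 1 / 4) * v"
proof -
  have v: "0 \<le> v" unfolding hyp_second_moment[symmetric] by simp
  have g1: "((k + 1 - c - 1 / 2)^3 + (k - c - 1 / 2)^3) / 2 = (k - c)^3 + 3 / 4 * (k - c)" for k :: real
    by (simp add: power3_eq_cube field_simps)
  have g2: "(k + 1 - c - 1 / 2)^3 - (k - c - 1 / 2)^3 = 3 * (k - c)^2 + 1 / 4" for k :: real
    by (simp add: power3_eq_cube power2_eq_square field_simps)
  have "EH (\<lambda>k. (k - c) * ((k - c)^3 + 3 / 4 * (k - c))) = EH (\<lambda>k. V k * (3 * (k - c)^2 + 1 / 4))"
    using hyp_stein_centered[of "\<lambda>k. (k - c - 1 / 2)^3"] by (simp only: g1 g2 of_int_add of_int_1)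
  moreover have "(\<lambda>k. (real_of_int k - c) * ((k - c)^3 + 3 / 4 * (k - c))) = (\<lambda>k. (k - c)^4 + 3 / 4 * (k - c)\<^sup>2)"
  proof
    have "y * (y^3 + 3 / 4 * y) = y^4 + 3 / 4 * y\<^sup>2" for y :: real
      by (simp add: power4_eq_xxxx power3_eq_cube power2_eq_square algebra_simps)
    then show "(real_of_int k - c) * ((k - c)^3 + 3 / 4 * (k - c)) = (k - c)^4 + 3 / 4 * (k - c)\<^sup>2" for k .
  qed
  moreover have "(\<lambda>k. V k * (3 * (k - c)^2 + 1 / 4)) = (\<lambda>k. 3 * (V k * (k - c)\<^sup>2) + 1 / 4 * V k)"
    by (simp add: algebra_simps)
  ultimately have "EH (\<lambda>k. (k - c)^4) + 3 / 4 * v = 3 * EH (\<lambda>k. V k * (k - c)\<^sup>2) + 1 / 4 * v"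
    by (simp only: EH_add EH_cmult hyp_second_moment hyp_mean_V)
  moreover have "EH (\<lambda>k. V k * (k - c)\<^sup>2) \<le> EH (\<lambda>k. N / 8 * (k - c)\<^sup>2)"
    by (intro integral_mono_AE hyp_int) (simp only: AE_measure_pmf_iff, intro ballI mult_right_mono hyp_V_le zero_le_power2)
  ultimately show ?thesis using v unfolding EH_cmult hyp_second_moment by (simp add: algebra_simps)
qed

text \<open>The fourth moment controls the quadratic part of \<open>V - v\<close>, the second moment
  the linear part.\<close>

lemma hyp_var_V: "EH (\<lambda>k. (V k - v)\<^sup>2) \<le> v * (1 / N + \<theta>\<^sup>2 / 2)"
proof -
  have v: "0 \<le> v" unfolding hyp_second_moment[symmetric] by simp
  have "EH (\<lambda>k. (V k - v)\<^sup>2) \<le> EH (\<lambda>k. 2 / N\<^sup>2 * ((k - c)^4 - 2 * v * (k - c)\<^sup>2 + v\<^sup>2) + \<theta>\<^sup>2 / 2 * (k - c)\<^sup>2)"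
  proof (intro integral_mono hyp_int)
    fix k :: int
    define a b where "a = ((real_of_int k - c)\<^sup>2 - v) / N" and "b = (k - c) * \<theta> / 2"
    have "(V k - v)\<^sup>2 = (a + b)\<^sup>2" by (simp add: V_def a_def b_def)
    also have "\<dots> \<le> 2 * a\<^sup>2 + 2 * b\<^sup>2"
      using zero_le_power2[of "a - b"] by (simp add: power2_eq_square algebra_simps)
    also have "2 * a\<^sup>2 = 2 / N\<^sup>2 * ((k - c)^4 - 2 * v * (k - c)\<^sup>2 + v\<^sup>2)"
    proof -
      have "(k - c)^4 = ((k - c)\<^sup>2)\<^sup>2" by (simp flip: power_mult)
      then show ?thesis by (simp add: a_def power_divide power2_diff[of "(k - c)\<^sup>2" v] mult_ac)
    qed
    also have "2 * b\<^sup>2 = \<theta>\<^sup>2 / 2 * (k - c)\<^sup>2"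
      by (simp add: b_def power2_eq_square)
    finally show "(V k - v)\<^sup>2 \<le> 2 / N\<^sup>2 * ((k - c)^4 - 2 * v * (k - c)\<^sup>2 + v\<^sup>2) + \<theta>\<^sup>2 / 2 * (k - c)\<^sup>2"
      by simp
  qed
  also have "\<dots> = 2 / N\<^sup>2 * (EH (\<lambda>k. (k - c)^4) - 2 * v * v + v\<^sup>2) + \<theta>\<^sup>2 / 2 * v"
    by (simp only: EH_add EH_diff EH_cmult hyp_second_moment) simp
  also have "\<dots> \<le> 2 / N\<^sup>2 * ((3 * N / 8 + 1 / 4) * v) + \<theta>\<^sup>2 / 2 * v"
  proof -
    have "0 \<le> v * v" by simp
    then have "EH (\<lambda>k. (k - c)^4) - 2 * v * v + v\<^sup>2 \<le> (3 * N / 8 + 1 / 4) * v"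
      using hyp_fourth_moment unfolding power2_eq_square by linarith
    then show ?thesis by (intro add_right_mono mult_left_mono) auto
  qed
  also have "2 / N\<^sup>2 * ((3 * N / 8 + 1 / 4) * v) \<le> 1 / N * v"
  proof -
    \<comment> \<open>The left side is \<open>3 / (4 * N) + 1 / (2 * N^2)\<close>, which is at most
      \<open>1 / N\<close> once \<open>N \<ge> 2\<close>.\<close>
    have "2 / N\<^sup>2 * (3 * N / 8 + 1 / 4) \<le> 1 / N"
      using N by (simp add: field_simps power2_eq_square)
    from mult_right_mono[OF this v] show ?thesis by (simp only: mult.assoc)
  qed
  finally show ?thesis by (simp add: algebra_simps)
qed

end

section \<open>Comparison with the translated binomial law\<close>

text \<open>The variance of \<open>Bi_hat\<close> misses \<open>v\<close> only by rounding. The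
  fluctuation of \<open>V\<close> yields the square root, rounding at most \<open>0.58 / v\<close>,
  and the tail term at most \<open>0.61 / v\<close>.\<close>

lemma d_TV_hyp_Bi_hat_le:
  fixes N n m :: nat and c v \<theta> :: real
  assumes N: "2 \<le> N" and le: "m \<le> N" "n \<le> N" and v: "v > 1.4"
    and c_def: "c = real n * real m / real N"
    and v_def: "v = real m * real n * (real N - real m) * (real N - real n) / ((real N - 1) * (real N)\<^sup>2)"
    and \<theta>_def: "\<theta> = (real N - 2 * real m) * (real N - 2 * real n) / (real N)\<^sup>2"
  shows "d_TV (hyp_pmf N n m) (Bi_hat c v) \<le> sqrt ((3 * \<theta>\<^sup>2 / 2 + 65 / (2 * real N)) / v) + 1.4 / v"
proof -
  define M where "M = nat \<lceil>4 * v\<rceil>"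
  define t where "t = tb_t c v"
  define p where "p = 1 / 2 - t"
  define s where "s = \<lfloor>tb_shift c v\<rfloor>"
  define V where "V k = v + ((real_of_int k - c)\<^sup>2 - v) / N + (k - c) * \<theta> / 2" for k
  let ?P = "hyp_pmf N n m"
  let ?E = "measure_pmf.expectation ?P"
  note facts = N le
  note fin = finite_set_hyp_pmf[OF facts]
  note int = integrable_measure_pmf_finite[OF fin]
  have v0: "v > 0" using v by simp
  have ceil: "of_int \<lceil>4 * v\<rceil> = real M" unfolding M_def using v by simp
  have M: "4 * v \<le> M" "M < 4 * v + 1" unfolding ceil[symmetric] by linarith+
  have M0: "0 < M" using M v by (metis gr0I less_le_trans mult_pos_pos not_less of_nat_0 v0 zero_less_numeral)
  \<comment> \<open>\<open>f\<close> is the fractional part in the numerator of \<open>tb_t\<close>;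
    \<open>f < 1\<close> and \<open>M < 4 * v + 1\<close> control all rounding.\<close>
  define f where "f = M * t"
  have f: "0 \<le> f" "f < 1"
    unfolding f_def t_def tb_t_def ceil using M0 by (auto simp: frac_lt_1)
  have t: "t = f / M" using M0 by (simp add: f_def)
  have t0: "0 \<le> t" using f by (simp add: t)
  have Mp: "M * p = M / 2 - f" using M0 by (simp add: p_def f_def right_diff_distrib)
  have Mp_ge: "M * p \<ge> 2 * v - 1" unfolding Mp using M f by linarith
  have p: "0 < p" "p \<le> 1 / 2"
  proof -
    have "0 < M * p" using Mp_ge v by linarith
    then show "0 < p" by (simp add: zero_less_mult_iff)
    show "p \<le> 1 / 2" using t0 by (simp add: p_def)
  qed
  have s: "c = real_of_int s + M * p"
  proof -
    have "tb_shift c v = real_of_int s"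
      using tb_shift_in_Ints[OF v0, of c] by (simp add: s_def of_int_floor)
    moreover have "tb_shift c v = c - M * p"
      unfolding tb_shift_def ceil t_def p_def by simp
    ultimately show ?thesis by simp
  qed
  define w where "w = M * p * (1 - p)"
  have "Bi_hat c v = map_pmf (\<lambda>k. int k + s) (binomial_pmf M p)"
    by (simp add: Bi_hat_def M_def s_def p_def t_def)
  moreover have "?E (\<lambda>k. (k - c) * ((g (k + 1) + g k) / 2)) = ?E (\<lambda>k. V k * (g (k + 1) - g k))" for g :: "int \<Rightarrow> real"
    using hyp_stein_centered[OF facts, of g] unfolding V_def c_def v_def \<theta>_def .
  moreover have Ex2: "?E (\<lambda>k. (k - c)\<^sup>2) = v"
    using hyp_second_moment[OF facts] unfolding c_def v_def .
  ultimately have d: "d_TV ?P (Bi_hat c v) \<le> ?E (\<lambda>k. \<bar>w - V k + t * (k - c)\<bar>) / w + v / (M * p)\<^sup>2"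
    using d_TV_shifted_binomial_le[OF fin p M0 s, of V] unfolding w_def by (simp add: p_def)
  have w: "w = M / 4 - f\<^sup>2 / M"
    using M0 by (simp add: w_def p_def t field_simps power2_eq_square)
  have "f\<^sup>2 \<le> 1" using f by (simp add: power_le_one)
  then have "f\<^sup>2 / M \<le> 1 / (4 * v)"
    using M v0 by (intro frac_le) auto
  moreover have "1 / (4 * v) \<le> (13 / 100) * v"
  proof -
    have "1.4 * 1.4 \<le> v * v" using v by (intro mult_mono) auto
    then show ?thesis using v0 by (simp add: field_simps)
  qed
  moreover have "1 / (4 * v) \<le> 1 / 4" using v by (simp add: field_simps)
  moreover have "0 \<le> f\<^sup>2 / M" by simp
  \<comment> \<open>\<open>M / 4\<close> exceeds \<open>v\<close> by at most \<open>1 / 4\<close>,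
    and the subtracted term lies between \<open>0\<close> and \<open>1 / 4\<close>. It is also at
    most \<open>0.13 * v\<close>, whence the factor \<open>0.87\<close>.\<close>
  ultimately have w_ge: "(87 / 100) * v \<le> w" and w_near: "\<bar>w - v\<bar> \<le> 1 / 4"
    unfolding w using M by linarith+
  have w0: "0 < w" using w_ge v0 by linarith
  define \<rho> where "\<rho> = 1 / N + \<theta>\<^sup>2 / 2"
  have \<rho>: "0 \<le> \<rho>" by (simp add: \<rho>_def)
  have absV: "?E (\<lambda>k. \<bar>V k - v\<bar>) \<le> sqrt (v * \<rho>)"
  proof -
    have "?E (\<lambda>k. (V k - v)\<^sup>2) \<le> v * \<rho>"
      using hyp_var_V[OF facts] unfolding V_def c_def v_def \<theta>_def \<rho>_def .
    then show ?thesis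
      using expectation_abs_le_sqrt[OF fin, of "\<lambda>k. V k - v"] by (meson order_trans real_sqrt_le_mono)
  qed
  have absx: "t * ?E (\<lambda>k. \<bar>k - c\<bar>) \<le> 1 / 4"
  proof -
    have "?E (\<lambda>k. \<bar>k - c\<bar>) \<le> sqrt v"
      using expectation_abs_le_sqrt[OF fin, of "\<lambda>k. k - c"] Ex2 by simp
    also have "sqrt v \<le> v" using v by (intro real_le_lsqrt) (auto simp: power2_eq_square)
    finally have "t * ?E (\<lambda>k. \<bar>k - c\<bar>) \<le> t * v" using t0 by (rule mult_left_mono)
    also have "\<dots> \<le> f / (4 * v) * v"
      unfolding t using f M v0 by (intro mult_right_mono divide_left_mono) auto
    also have "\<dots> \<le> 1 / 4" using f v0 by simp
    finally show ?thesis .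
  qed
  have "?E (\<lambda>k. \<bar>w - V k + t * (k - c)\<bar>) \<le> ?E (\<lambda>k. 1 / 4 + \<bar>V k - v\<bar> + t * \<bar>k - c\<bar>)"
  proof (intro integral_mono int)
    fix k :: int
    have "w - V k + t * (k - c) = (w - v) - (V k - v) + t * (k - c)" by simp
    also have "\<bar>\<dots>\<bar> \<le> \<bar>w - v\<bar> + \<bar>V k - v\<bar> + \<bar>t * (k - c)\<bar>" by linarith
    also have "\<dots> \<le> 1 / 4 + \<bar>V k - v\<bar> + t * \<bar>k - c\<bar>" using w_near t0 by (simp add: abs_mult)
    finally show "\<bar>w - V k + t * (k - c)\<bar> \<le> 1 / 4 + \<bar>V k - v\<bar> + t * \<bar>k - c\<bar>" .
  qed
  also have "\<dots> = 1 / 4 + ?E (\<lambda>k. \<bar>V k - v\<bar>) + t * ?E (\<lambda>k. \<bar>k - c\<bar>)"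
    by (simp add: Bochner_Integration.integral_add[OF int int])
  also have "\<dots> \<le> sqrt (v * \<rho>) + 1 / 2" using absV absx by simp
  finally have "?E (\<lambda>k. \<bar>w - V k + t * (k - c)\<bar>) / w \<le> (sqrt (v * \<rho>) + 1 / 2) / ((87 / 100) * v)"
    using w_ge w0 v0 \<rho> by (intro frac_le) auto
  also have "\<dots> \<le> sqrt ((3 * \<theta>\<^sup>2 / 2 + 65 / (2 * real N)) / v) + (58 / 100) / v"
  proof -
    \<comment> \<open>Compare squares: \<open>0.7569\<close> is the square of
      \<open>0.87\<close>.\<close>
    have "(sqrt (v * \<rho>) / ((87 / 100) * v))\<^sup>2 = \<rho> / ((7569 / 10000) * v)"
      using v0 \<rho> by (simp add: power_divide power_mult_distrib power2_eq_square)
    also have "\<dots> \<le> (3 * \<theta>\<^sup>2 / 2 + 65 / (2 * real N)) / v"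
    proof -
      have "\<rho> / (7569 / 10000) \<le> 3 * \<theta>\<^sup>2 / 2 + 65 / (2 * real N)"
      proof -
        define e q where "e = 1 / real N" and "q = \<theta>\<^sup>2"
        have "0 \<le> e" "0 \<le> q" by (simp_all add: e_def q_def)
        then have "(e + q / 2) / (7569 / 10000) \<le> 3 * q / 2 + 65 / 2 * e" by (simp add: field_simps)
        then show ?thesis by (simp add: \<rho>_def e_def q_def)
      qed
      from divide_right_mono[OF this, of v] v0 show ?thesis by simp
    qed
    finally have "sqrt (v * \<rho>) / ((87 / 100) * v) \<le> sqrt ((3 * \<theta>\<^sup>2 / 2 + 65 / (2 * real N)) / v)"
      by (rule real_le_rsqrt)
    moreover have "1 / 2 / ((87 / 100) * v) \<le> (58 / 100) / v" using v0 by (simp add: field_simps)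
    ultimately show ?thesis unfolding add_divide_distrib by linarith
  qed
  finally have A: "?E (\<lambda>k. \<bar>w - V k + t * (k - c)\<bar>) / w \<le> \<dots>" .
  have "v / (M * p)\<^sup>2 \<le> (61 / 100) / v"
  proof -
    \<comment> \<open>Follows from \<open>M * p \<ge> 2 * v - 1\<close> and \<open>v > 1.4\<close>;
      the square of \<open>0.78\<close> is below \<open>0.61\<close>.\<close>
    have "v \<le> (78 / 100) * (M * p)" using Mp_ge v by linarith
    then have "v * v \<le> ((78 / 100) * (M * p)) * ((78 / 100) * (M * p))" using v0 by (intro mult_mono) auto
    also have "\<dots> \<le> (61 / 100) * (M * p)\<^sup>2"
      using p by (simp add: power2_eq_square)
    finally have "v * v \<le> (61 / 100) * (M * p)\<^sup>2" .
    then show ?thesis using v0 M0 p by (simp add: field_simps)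
  qed
  moreover have "(58 / 100) / v + (61 / 100) / v \<le> 1.4 / v" using v0 by (simp add: field_simps)
  ultimately show ?thesis using d A by linarith
qed

theorem theorem1p7:
  fixes N n m :: nat and \<mu> \<sigma> :: real
  assumes "N \<ge> 4" and "1 \<le> m" and "m < N" and "1 \<le> n" and "n < N"
    and "\<mu> = measure_pmf.expectation (hyp_pmf N n m) real_of_int"
    and "\<sigma> \<ge> 0"
    and "\<sigma>\<^sup>2 = measure_pmf.variance (hyp_pmf N n m) real_of_int"
  shows "\<sigma>\<^sup>2 = real m * real n * (real N - real m) * (real N - real n)
                 / ((real N - 1) * (real N)\<^sup>2)
    \<and> (1 / 2 - tb_t \<mu> (\<sigma>\<^sup>2) \<ge> 0 \<longrightarrow>
        d_TV (hyp_pmf N n m) (Bi_hat \<mu> (\<sigma>\<^sup>2))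
          \<le> sqrt (6 * (real N - 2 * real m)\<^sup>2 * (real N - 2 * real n)\<^sup>2 / (real N)^3 + 130)
               / (2 * sqrt (real N) * \<sigma>)
             + 1.4 / \<sigma>\<^sup>2)"
proof (intro conjI impI)
  have N: "2 \<le> N" and le: "m \<le> N" "n \<le> N" using assms by auto
  have \<mu>: "\<mu> = real n * real m / real N" using hyp_mean[OF N le] assms(6) by simp
  show var: "\<sigma>\<^sup>2 = real m * real n * (real N - real m) * (real N - real n) / ((real N - 1) * (real N)\<^sup>2)"
    unfolding assms(8) assms(6)[symmetric] \<mu> using hyp_second_moment[OF N le] by simp
  let ?b = "sqrt (6 * (real N - 2 * real m)\<^sup>2 * (real N - 2 * real n)\<^sup>2 / (real N)^3 + 130) / (2 * sqrt (real N) * \<sigma>)"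
  have \<sigma>: "0 < \<sigma>\<^sup>2" unfolding var using assms by simp
  show "d_TV (hyp_pmf N n m) (Bi_hat \<mu> (\<sigma>\<^sup>2)) \<le> ?b + 1.4 / \<sigma>\<^sup>2"
  proof (cases "\<sigma>\<^sup>2 > 1.4")
    \<comment> \<open>For small variance \<open>1.4 / \<sigma>\<^sup>2\<close> alone is at least
      \<open>1\<close>, which no total variation distance exceeds.\<close>
    case False
    then have "1 \<le> 1.4 / \<sigma>\<^sup>2" using \<sigma> by (simp add: field_simps)
    moreover have "0 \<le> ?b" using assms(7) by simp
    ultimately show ?thesis using d_TV_le_1[of "hyp_pmf N n m" "Bi_hat \<mu> (\<sigma>\<^sup>2)"] by linarith
  next
    case True
    define \<theta> where "\<theta> = (real N - 2 * real m) * (real N - 2 * real n) / (real N)\<^sup>2"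
    define X where "X = (real N - 2 * real m)\<^sup>2 * (real N - 2 * real n)\<^sup>2"
    have "\<theta>\<^sup>2 = X / real N^4"
      by (simp add: \<theta>_def X_def power_divide power_mult_distrib flip: power_mult)
    \<comment> \<open>The factor \<open>4 * N\<close> comes from moving \<open>2 * sqrt N\<close>
      under the root.\<close>
    then have "3 * \<theta>\<^sup>2 / 2 + 65 / (2 * real N) = (6 * X / (real N)^3 + 130) / (2\<^sup>2 * real N)"
      using N by (simp add: field_simps power3_eq_cube power4_eq_xxxx)
    then have "(3 * \<theta>\<^sup>2 / 2 + 65 / (2 * real N)) / \<sigma>\<^sup>2
      = (6 * (real N - 2 * real m)\<^sup>2 * (real N - 2 * real n)\<^sup>2 / (real N)^3 + 130) / (2\<^sup>2 * real N * \<sigma>\<^sup>2)"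
      by (simp add: X_def mult.assoc)
    then have "sqrt ((3 * \<theta>\<^sup>2 / 2 + 65 / (2 * real N)) / \<sigma>\<^sup>2) = ?b"
      using assms(7) by (simp only: real_sqrt_divide real_sqrt_mult real_sqrt_abs abs_of_nonneg abs_numeral)
    then show ?thesis using d_TV_hyp_Bi_hat_le[OF N le True \<mu> var \<theta>_def] by simp
  qed
qed

end
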